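(* Let $\mathbb{P}^{\tilde e}$ be a constraint-free extended multi-adjoint logic program (EMALP) on an extended multi-adjoint lattice with carrier $L$, let $\neg\colon L\to L$ be an involutive negation operator, let $\mathbb{P}$ be the corresponding multi-adjoint normal logic program (MANLP) of $\mathbb{P}^{\tilde e}$ built with $\neg$, and let $\mathcal{N}_{\mathbb{P}^{\tilde e}}$ be the set of propositional symbols that appear in an order-reversing argument position of an extended aggregator in the body of some rule in $\mathbb{P}^{\tilde e}$. Then any stable model $M$ of the MANLP $\mathbb{P}$ satisfies $M(\mathrm{not}_q)=\hat M(\neg q)$ for all $q\in\mathcal{N}_{\mathbb{P}^{\tilde e}}$.
   Context: Adjoint pair: given a partially ordered set $(P,\leq)$, a pair $(\&,\leftarrow)$ of binary operations on $P$ is an adjoint pair if $\&$ is order-preserving in both arguments; $\leftarrow$ is order-preserving in its first argument (the consequent) and order-reversing in its second argument (the antecedent), i.e. $z\leftarrow y$ is increasing in $z$ and decreasing in $y$; and $x\leq (z\leftarrow y)$ iff $(x\& y)\leq z$ for all $x,y,z\in P$. Multi-adjoint lattice: a tuple $(L,\preceq,\leftarrow_1,\&_1,\dots,\leftarrow_r,\&_r)$ where $(L,\preceq)$ is a bounded lattice with bottom $\bot$ and top $\top$, each $(\&_i,\leftarrow_i)$ is an adjoint pair in $(L,\preceq)$, and $\top\&_i\vartheta=\vartheta\&_i\top=\vartheta$ for all $\vartheta\in L$ and all $i$. A negation operator is an order-reversing mapping $\neg\colon L\to L$ with $\neg\bot=\top$, $\neg\top=\bot$; it is involutive if $\neg\neg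 x=x$ for all $x$. A multi-adjoint lattice together with a negation operator is a multi-adjoint normal lattice. Extended aggregator: a mapping $@^e\colon L^n\to L$ on a complete lattice $(L,\preceq)$ which is order-preserving in its first $m$ arguments and order-reversing in its last $n-m$ arguments; one writes $@^e[x_1,\dots,x_m;x_{m+1},\dots,x_n]$. An extended multi-adjoint lattice is a multi-adjoint lattice, with $(L,\preceq)$ complete, enriched with a finite family of extended aggregators $@^e_1,\dots,@^e_k$ (arities $n$ and numbers $m$ may depend on the aggregator). An aggregator operator is a mapping $@\colon L^n\to L$ order-preserving in all arguments (no boundary conditions required). Constraint-free EMALP: a finite set $\mathbb{P}^{\tilde e}$ of weighted rules $\langle p\leftarrow_i @^e[p_1,\dots,p_m;p_{m+1},\dots,p_n];\vartheta\rangle$, where $i\in\{1,\dots,r\}$, $@^e$ is one of the extended aggregators of the lattice, $\vartheta\in L$, and $p,p_1,\dots,p_n$ are propositional symbols with $p_1,\dots,p_n$ pairwise distinct. MANLP: on a multi-adjoint normal lattice, a finite set $\mathbb{P}$ of weighted rules $\langle p\leftarrow_i @[p_1,\dots,p_m,\neg p_{m+1},\dots,\neg p_n];\vartheta\rangle$, with $@$ an aggregator operator, $\vartheta\in L$, and $p,p_1,\dots,p_n$ propositional symbols with $p_1,\dots,p_n$ pairwise distinct. Semantics of MANLPs: $\Pi_{\mathbb{P}}$ is the set of propositional symbols of $\mathbb{P}$; an interpretation is a mapping $I\colon\Pi_{\mathbb{P}}\to L$, extended to formulas inductively as $\hat I$ (so $\hat I(\neg q)=\neg(I(q))$ and elements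 of $L$ evaluate to themselves). A rule $\langle p\leftarrow_i\mathcal{B};\vartheta\rangle$ is satisfied by $I$ iff $\vartheta\preceq I(p)\leftarrow_i\hat I(\mathcal{B})$; a model satisfies all rules; the least model is a model that is pointwise $\preceq$ every model. The reduct $\mathbb{P}_M$ with respect to an interpretation $M$ replaces each body $@[p_1,\dots,p_m,\neg p_{m+1},\dots,\neg p_n]$ by $@_M[p_1,\dots,p_m]$, where $@_M[\vartheta_1,\dots,\vartheta_m]=@[\vartheta_1,\dots,\vartheta_m,\neg M(p_{m+1}),\dots,\neg M(p_n)]$. (Models of the reduct are taken among interpretations with the same domain as $M$.) $M$ is a stable model of $\mathbb{P}$ if it is the least model of $\mathbb{P}_M$. Corresponding MANLP: let $\Pi_{\mathbb{P}^{\tilde e}}$ be the set of propositional symbols of $\mathbb{P}^{\tilde e}$. For each $q\in\mathcal{N}_{\mathbb{P}^{\tilde e}}$ let $\mathrm{not}_q\notin\Pi_{\mathbb{P}^{\tilde e}}$ be a new propositional symbol (distinct for distinct $q$). Given an involutive negation operator $\neg$ on $L$, the corresponding MANLP $\mathbb{P}$, on the multi-adjoint normal lattice $(L,\preceq,\leftarrow_1,\&_1,\dots,\leftarrow_r,\&_r,\neg)$, consists of the rules $\langle p\leftarrow_i @[p_1,\dots,p_m,\mathrm{not}_{p_{m+1}},\dots,\mathrm{not}_{p_n}];\vartheta\rangle$ for every $\langle p\leftarrow_i @^e[p_1,\dots,p_m;p_{m+1},\dots,p_n];\vartheta\rangle\in\mathbb{P}^{\tilde e}$, together with one rule $\langle\mathrm{not}_q\leftarrow_j\neg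 q;\top\rangle$ for every $q\in\mathcal{N}_{\mathbb{P}^{\tilde e}}$ (with $j\in\{1,\dots,r\}$), where $@$ is the aggregator operator $@[\vartheta_1,\dots,\vartheta_n]=@^e[\vartheta_1,\dots,\vartheta_m;\neg\vartheta_{m+1},\dots,\neg\vartheta_n]$. Interpretations of $\mathbb{P}$ are mappings $\Pi_{\mathbb{P}^{\tilde e}}\cup\{\mathrm{not}_q\mid q\in\mathcal{N}_{\mathbb{P}^{\tilde e}}\}\to L$. *)

theory Defs
  imports Main "HOL-Library.FuncSet"
begin

section \<open>Multi-adjoint lattices\<close>

definition adjoint_pair ::
  "('l::order \<Rightarrow> 'l \<Rightarrow> 'l) \<Rightarrow> ('l \<Rightarrow> 'l \<Rightarrow> 'l) \<Rightarrow> bool" where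
  "adjoint_pair amp imp \<longleftrightarrow>
     (\<forall>y. mono (\<lambda>x. amp x y)) \<and> (\<forall>x. mono (\<lambda>y. amp x y)) \<and>
     (\<forall>y. mono (\<lambda>z. imp z y)) \<and> (\<forall>z. antimono (\<lambda>y. imp z y)) \<and>
     (\<forall>x y z. x \<le> imp z y \<longleftrightarrow> amp x y \<le> z)"

definition multi_adjoint_lattice ::
  "nat \<Rightarrow> (nat \<Rightarrow> 'l::bounded_lattice \<Rightarrow> 'l \<Rightarrow> 'l) \<Rightarrow> (nat \<Rightarrow> 'l \<Rightarrow> 'l \<Rightarrow> 'l) \<Rightarrow> bool" where
  "multi_adjoint_lattice r amp imp \<longleftrightarrow>
     (\<forall>i\<in>{1..r}. adjoint_pair (amp i) (imp i) \<and>
        (\<forall>x. amp i top x = x \<and> amp i x top = x))"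

definition negation_operator :: "('l::bounded_lattice \<Rightarrow> 'l) \<Rightarrow> bool" where
  "negation_operator neg \<longleftrightarrow> antimono neg \<and> neg bot = top \<and> neg top = bot"

definition involutive :: "('l \<Rightarrow> 'l) \<Rightarrow> bool" where
  "involutive neg \<longleftrightarrow> (\<forall>x. neg (neg x) = x)"

text \<open>
  A mapping from the n-th power of the carrier is a function on lists of which only the
  values on lists of length n matter.  With 0-based positions, the first m arguments are
  those at positions below m.
\<close>

definition mono_antimono_args :: "nat \<Rightarrow> nat \<Rightarrow> ('l::order list \<Rightarrow> 'l) \<Rightarrow> bool" where
  "mono_antimono_args m n f \<longleftrightarrow>
     (\<forall>xs. length xs = n \<longrightarrow>
        (\<forall>i<m. mono (\<lambda>y. f (xs[i := y]))) \<and>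
        (\<forall>i. m \<le> i \<and> i < n \<longrightarrow> antimono (\<lambda>y. f (xs[i := y]))))"

definition aggregator_operator :: "nat \<Rightarrow> ('l::order list \<Rightarrow> 'l) \<Rightarrow> bool" where
  "aggregator_operator n f \<longleftrightarrow>
     (\<forall>xs. length xs = n \<longrightarrow> (\<forall>i<n. mono (\<lambda>y. f (xs[i := y]))))"

datatype 'l ext_aggregator =
  ExtAggregator (preserving: nat) (arity: nat) (agg_fun: "'l list \<Rightarrow> 'l")

definition extended_aggregator :: "'l::complete_lattice ext_aggregator \<Rightarrow> bool" where
  "extended_aggregator A \<longleftrightarrow>
     preserving A \<le> arity A \<and> mono_antimono_args (preserving A) (arity A) (agg_fun A)"

definition extended_multi_adjoint_lattice ::
  "nat \<Rightarrow> (nat \<Rightarrow> 'l::complete_lattice \<Rightarrow> 'l \<Rightarrow> 'l) \<Rightarrow> (nat \<Rightarrow> 'l \<Rightarrow> 'l \<Rightarrow> 'l) \<Rightarrow>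
     nat \<Rightarrow> (nat \<Rightarrow> 'l ext_aggregator) \<Rightarrow> bool" where
  "extended_multi_adjoint_lattice r amp imp k agg \<longleftrightarrow>
     multi_adjoint_lattice r amp imp \<and> (\<forall>e\<in>{1..k}. extended_aggregator (agg e))"

section \<open>Multi-adjoint normal logic programs\<close>

datatype ('a, 'l) formula =
    Atom 'a
  | Truth 'l
  | Neg "('a, 'l) formula"
  | Aggr "'l list \<Rightarrow> 'l" "('a, 'l) formula list"

primrec hat :: "('l \<Rightarrow> 'l) \<Rightarrow> ('a \<Rightarrow> 'l) \<Rightarrow> ('a, 'l) formula \<Rightarrow> 'l" where
  "hat neg I (Atom p) = I p"
| "hat neg I (Truth x) = x"
| "hat neg I (Neg F) = neg (hat neg I F)"
| "hat neg I (Aggr f Fs) = f (map (hat neg I) Fs)"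

text \<open>
  \<open>Rule p i f ps qs t\<close> is the rule with head \<open>p\<close>, implication number \<open>i\<close>, weight \<open>t\<close>
  and the aggregator \<open>f\<close> applied to the atoms \<open>ps\<close> followed by the negated atoms \<open>qs\<close>.
\<close>

datatype ('a, 'l) rule =
  Rule (head: 'a) (impl: nat) (aggr: "'l list \<Rightarrow> 'l")
    (pos_atoms: "'a list") (neg_atoms: "'a list") (weight: 'l)

definition body :: "('a, 'l) rule \<Rightarrow> ('a, 'l) formula" where
  "body R = Aggr (aggr R) (map Atom (pos_atoms R) @ map (\<lambda>q. Neg (Atom q)) (neg_atoms R))"

definition manlp :: "nat \<Rightarrow> ('a, 'l::order) rule set \<Rightarrow> bool" where
  "manlp r P \<longleftrightarrow>
     finite P \<and>
     (\<forall>R\<in>P. impl R \<in> {1..r} \<and>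
        aggregator_operator (length (pos_atoms R @ neg_atoms R)) (aggr R) \<and>
        distinct (pos_atoms R @ neg_atoms R))"

definition symbols :: "('a, 'l) rule set \<Rightarrow> 'a set" where
  "symbols P = (\<Union>R\<in>P. {head R} \<union> set (pos_atoms R) \<union> set (neg_atoms R))"

definition satisfies ::
  "(nat \<Rightarrow> 'l::order \<Rightarrow> 'l \<Rightarrow> 'l) \<Rightarrow> ('l \<Rightarrow> 'l) \<Rightarrow> ('a \<Rightarrow> 'l) \<Rightarrow> ('a, 'l) rule \<Rightarrow> bool" where
  "satisfies imp neg I R \<longleftrightarrow> weight R \<le> imp (impl R) (I (head R)) (hat neg I (body R))"

text \<open>
  The domain \<open>D\<close> of the interpretations is explicit because the reduct of a program may
  mention fewer symbols than the program itself.
\<close>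

definition model ::
  "(nat \<Rightarrow> 'l::order \<Rightarrow> 'l \<Rightarrow> 'l) \<Rightarrow> ('l \<Rightarrow> 'l) \<Rightarrow> 'a set \<Rightarrow> ('a, 'l) rule set \<Rightarrow>
     ('a \<Rightarrow> 'l) \<Rightarrow> bool" where
  "model imp neg D P I \<longleftrightarrow> I \<in> D \<rightarrow>\<^sub>E UNIV \<and> (\<forall>R\<in>P. satisfies imp neg I R)"

definition least_model ::
  "(nat \<Rightarrow> 'l::order \<Rightarrow> 'l \<Rightarrow> 'l) \<Rightarrow> ('l \<Rightarrow> 'l) \<Rightarrow> 'a set \<Rightarrow> ('a, 'l) rule set \<Rightarrow>
     ('a \<Rightarrow> 'l) \<Rightarrow> bool" where
  "least_model imp neg D P M \<longleftrightarrow>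
     model imp neg D P M \<and> (\<forall>J. model imp neg D P J \<longrightarrow> (\<forall>p\<in>D. M p \<le> J p))"

definition reduct_rule ::
  "('l \<Rightarrow> 'l) \<Rightarrow> ('a \<Rightarrow> 'l) \<Rightarrow> ('a, 'l) rule \<Rightarrow> ('a, 'l) rule" where
  "reduct_rule neg M R =
     Rule (head R) (impl R)
       (\<lambda>xs. aggr R (xs @ map (\<lambda>q. neg (M q)) (neg_atoms R)))
       (pos_atoms R) [] (weight R)"

definition reduct ::
  "('l \<Rightarrow> 'l) \<Rightarrow> ('a \<Rightarrow> 'l) \<Rightarrow> ('a, 'l) rule set \<Rightarrow> ('a, 'l) rule set" where
  "reduct neg M P = reduct_rule neg M ` P"

definition stable_model ::
  "(nat \<Rightarrow> 'l::order \<Rightarrow> 'l \<Rightarrow> 'l) \<Rightarrow> ('l \<Rightarrow> 'l) \<Rightarrow> ('a, 'l) rule set \<Rightarrow> ('a \<Rightarrow> 'l) \<Rightarrow> bool" where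
  "stable_model imp neg P M \<longleftrightarrow> least_model imp neg (symbols P) (reduct neg M P) M"

section \<open>Constraint-free extended multi-adjoint logic programs\<close>

text \<open>
  \<open>ERule p i e ps qs t\<close> has head \<open>p\<close>, implication number \<open>i\<close>, weight \<open>t\<close> and, as body, the
  extended aggregator number \<open>e\<close> applied to \<open>ps\<close> in its order-preserving and to \<open>qs\<close> in
  its order-reversing positions.  Heads are propositional symbols, so that there are no
  constraints.
\<close>

datatype ('a, 'l) erule =
  ERule (ehead: 'a) (eimpl: nat) (eaggr: nat)
    (epos_atoms: "'a list") (eneg_atoms: "'a list") (eweight: 'l)

definition constraint_free_emalp ::
  "nat \<Rightarrow> nat \<Rightarrow> (nat \<Rightarrow> 'l ext_aggregator) \<Rightarrow> ('a, 'l) erule set \<Rightarrow> bool" where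
  "constraint_free_emalp r k agg Pe \<longleftrightarrow>
     finite Pe \<and>
     (\<forall>R\<in>Pe. eimpl R \<in> {1..r} \<and> eaggr R \<in> {1..k} \<and>
        length (epos_atoms R) = preserving (agg (eaggr R)) \<and>
        length (epos_atoms R @ eneg_atoms R) = arity (agg (eaggr R)) \<and>
        distinct (epos_atoms R @ eneg_atoms R))"

definition esymbols :: "('a, 'l) erule set \<Rightarrow> 'a set" where
  "esymbols Pe = (\<Union>R\<in>Pe. {ehead R} \<union> set (epos_atoms R) \<union> set (eneg_atoms R))"

definition reversing_symbols :: "('a, 'l) erule set \<Rightarrow> 'a set" where
  "reversing_symbols Pe = (\<Union>R\<in>Pe. set (eneg_atoms R))"

section \<open>The corresponding normal program\<close>

definition fresh_symbols :: "('a \<Rightarrow> 'a) \<Rightarrow> ('a, 'l) erule set \<Rightarrow> bool" where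
  "fresh_symbols nt Pe \<longleftrightarrow>
     inj_on nt (reversing_symbols Pe) \<and> nt ` reversing_symbols Pe \<inter> esymbols Pe = {}"

definition corresponding_aggr :: "('l \<Rightarrow> 'l) \<Rightarrow> 'l ext_aggregator \<Rightarrow> 'l list \<Rightarrow> 'l" where
  "corresponding_aggr neg A xs =
     agg_fun A (take (preserving A) xs @ map neg (drop (preserving A) xs))"

definition corresponding_rule ::
  "(nat \<Rightarrow> 'l ext_aggregator) \<Rightarrow> ('l \<Rightarrow> 'l) \<Rightarrow> ('a \<Rightarrow> 'a) \<Rightarrow> ('a, 'l) erule \<Rightarrow>
     ('a, 'l) rule" where
  "corresponding_rule agg neg nt R =
     Rule (ehead R) (eimpl R) (corresponding_aggr neg (agg (eaggr R)))
       (epos_atoms R @ map nt (eneg_atoms R)) [] (eweight R)"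

text \<open>The body consisting of a single negated atom uses the unary identity aggregator, \<open>hd\<close>.\<close>

definition not_rule ::
  "('a \<Rightarrow> nat) \<Rightarrow> ('a \<Rightarrow> 'a) \<Rightarrow> 'a \<Rightarrow> ('a, 'l::bounded_lattice) rule" where
  "not_rule j nt q = Rule (nt q) (j q) hd [] [q] top"

definition corresponding_manlp ::
  "(nat \<Rightarrow> 'l::bounded_lattice ext_aggregator) \<Rightarrow> ('l \<Rightarrow> 'l) \<Rightarrow> ('a \<Rightarrow> 'a) \<Rightarrow> ('a \<Rightarrow> nat) \<Rightarrow>
     ('a, 'l) erule set \<Rightarrow> ('a, 'l) rule set" where
  "corresponding_manlp agg neg nt j Pe =
     corresponding_rule agg neg nt ` Pe \<union> not_rule j nt ` reversing_symbols Pe"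

lemma symbols_corresponding_manlp:
  "symbols (corresponding_manlp agg neg nt j Pe) =
     esymbols Pe \<union> nt ` reversing_symbols Pe"
  unfolding symbols_def corresponding_manlp_def esymbols_def reversing_symbols_def
    corresponding_rule_def not_rule_def
  by fastforce

lemma aggregator_operator_corresponding_aggr:
  assumes "extended_aggregator A" and "antimono neg"
  shows "aggregator_operator (arity A) (corresponding_aggr neg A)"
  unfolding aggregator_operator_def
proof (intro allI impI)
  fix xs :: "'a list" and i
  assume len: "length xs = arity A" and i: "i < arity A"
  define m where "m = preserving A"
  define zs where "zs = take m xs @ map neg (drop m xs)"
  have m: "m \<le> arity A" and mm: "mono_antimono_args m (arity A) (agg_fun A)"
    using assms(1) by (auto simp: extended_aggregator_def m_def)
  have zs: "length zs = arity A" using len m by (simp add: zs_def)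
  show "mono (\<lambda>y. corresponding_aggr neg A (xs[i := y]))"
  proof (cases "i < m")
    case True
    then have "corresponding_aggr neg A (xs[i := y]) = agg_fun A (zs[i := y])" for y
      using len m
      by (simp add: corresponding_aggr_def m_def[symmetric] zs_def take_update_swap
          list_update_append)
    then show ?thesis
      using mm zs True by (simp add: mono_antimono_args_def)
  next
    case False
    then have "corresponding_aggr neg A (xs[i := y]) = agg_fun A (zs[i := neg y])" for y
      using len m
      by (simp add: corresponding_aggr_def m_def[symmetric] zs_def drop_update_swap
          list_update_append map_update min_absorb2)
    moreover have "antimono (\<lambda>y. agg_fun A (zs[i := y]))"
      using mm zs False i by (simp add: mono_antimono_args_def)
    ultimately show ?thesis
      using assms(2) by (simp add: monotone_def)
  qed
qed

lemma manlp_corresponding_manlp: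
  assumes "extended_multi_adjoint_lattice r amp imp k agg"
    and "constraint_free_emalp r k agg Pe"
    and "negation_operator neg"
    and "fresh_symbols nt Pe"
    and "\<forall>q\<in>reversing_symbols Pe. j q \<in> {1..r}"
  shows "manlp r (corresponding_manlp agg neg nt j Pe)"
proof -
  have fin: "finite (corresponding_manlp agg neg nt j Pe)"
    using assms(2)
    by (auto simp: corresponding_manlp_def constraint_free_emalp_def reversing_symbols_def)
  have hd: "aggregator_operator (Suc 0) (hd :: 'a list \<Rightarrow> 'a)"
    by (auto simp: aggregator_operator_def length_Suc_conv monotone_def)
  have "impl R \<in> {1..r} \<and>
        aggregator_operator (length (pos_atoms R @ neg_atoms R)) (aggr R) \<and>
        distinct (pos_atoms R @ neg_atoms R)"
    if R: "R \<in> corresponding_manlp agg neg nt j Pe" for R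
  proof -
    consider S where "S \<in> Pe" "R = corresponding_rule agg neg nt S"
      | q where "q \<in> reversing_symbols Pe" "R = not_rule j nt q"
      using R unfolding corresponding_manlp_def by blast
    then show ?thesis
    proof cases
      case 1
      have S: "eimpl S \<in> {1..r}" "extended_aggregator (agg (eaggr S))"
          "length (epos_atoms S @ eneg_atoms S) = arity (agg (eaggr S))"
          "distinct (epos_atoms S @ eneg_atoms S)"
        using 1(1) assms(1,2)
        by (auto simp: constraint_free_emalp_def extended_multi_adjoint_lattice_def)
      have "set (eneg_atoms S) \<subseteq> reversing_symbols Pe" "set (epos_atoms S) \<subseteq> esymbols Pe"
        using 1(1) by (auto simp: reversing_symbols_def esymbols_def)
      then have "distinct (epos_atoms S @ map nt (eneg_atoms S))"
        using S(4) assms(4)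
        by (auto simp: fresh_symbols_def distinct_map intro: inj_on_subset)
      then show ?thesis
        using 1(2) S assms(3) aggregator_operator_corresponding_aggr[OF S(2), of neg]
        by (simp add: corresponding_rule_def negation_operator_def)
    next
      case 2
      then show ?thesis using hd assms(5) by (simp add: not_rule_def)
    qed
  qed
  then show ?thesis using fin by (simp add: manlp_def)
qed

end

(* The only rule with head not_q is satisfied exactly by the interpretations whose value at not_q
   dominates the negation of q.  A stable model M attains this bound: lowering M(not_q) to it
   only decreases the bodies of the reduct, so it leaves a model of the reduct. *)

theory Submission
  imports Defs
begin

text \<open>Monotonicity in each single argument yields joint monotonicity by exchanging the entries
  one at a time.\<close>

lemma aggregator_operator_mono:
  assumes f: "aggregator_operator (length ys) f" and le: "list_all2 (\<le>) xs ys"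
  shows "f xs \<le> f ys"
proof -
  have len: "length xs = length ys"
    using le by (rule list_all2_lengthD)
  \<comment> \<open>The intermediate list has its first \<open>k\<close> entries exchanged already;
    passing to \<open>Suc k\<close> changes position \<open>k\<close> alone, from
    \<open>xs ! k\<close> to \<open>ys ! k\<close>.\<close>
  have "f xs \<le> f (take k ys @ drop k xs)" if "k \<le> length ys" for k
    using that
  proof (induction k)
    case (Suc k)
    define zs where "zs = take k ys @ drop k xs"
    have k: "k < length ys" using Suc.prems by simp
    have "zs[k := xs ! k] = zs"
      using k len by (simp add: zs_def list_update_append nth_append list_update_same_conv)
    moreover have "zs[k := ys ! k] = take (Suc k) ys @ drop (Suc k) xs"
      using k len by (simp add: zs_def list_update_append take_Suc_conv_app_nth min_absorb2
          Cons_nth_drop_Suc[symmetric])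
    moreover have "mono (\<lambda>y. f (zs[k := y]))"
      using f k len by (simp add: aggregator_operator_def zs_def)
    then have "f (zs[k := xs ! k]) \<le> f (zs[k := ys ! k])"
      using le k len by (auto intro: monoD dest: list_all2_nthD)
    ultimately show ?case
      using Suc.IH k unfolding zs_def by auto
  qed simp
  from this[of "length ys"] show ?thesis using len by simp
qed

lemma hat_body_reduct_rule:
  "hat neg I (body (reduct_rule neg M R)) =
     aggr R (map I (pos_atoms R) @ map (\<lambda>q. neg (M q)) (neg_atoms R))"
  by (simp add: body_def reduct_rule_def comp_def)

lemma hat_body:
  "hat neg I (body R) = aggr R (map I (pos_atoms R) @ map (\<lambda>q. neg (I q)) (neg_atoms R))"
  by (simp add: body_def comp_def)

text \<open>Evaluated at \<open>M\<close> itself, the body of a rule and that of its reduct with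
  respect to \<open>M\<close> agree, so a stable model also satisfies the original rules.\<close>

lemma stable_model_weight_le:
  assumes "stable_model imp neg P M" and "R \<in> P"
  shows "weight R \<le> imp (impl R) (M (head R)) (hat neg M (body R))"
proof -
  have "satisfies imp neg M (reduct_rule neg M R)"
    using assms by (simp add: stable_model_def least_model_def model_def reduct_def)
  then show ?thesis
    by (simp add: satisfies_def hat_body_reduct_rule hat_body) (simp add: reduct_rule_def)
qed

text \<open>Turns minimality of \<open>M\<close> into a test at a single symbol: only the rules with
  head \<open>p\<close> can obstruct lowering \<open>M p\<close>, and their bodies may be evaluated
  at \<open>M\<close>.\<close>

lemma stable_model_value_least:
  assumes mal: "multi_adjoint_lattice r amp imp"
    and P: "manlp r P" and M: "stable_model imp neg P M"
    and p: "p \<in> symbols P" and v: "v \<le> M p"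
    and heads: "\<And>R. R \<in> P \<Longrightarrow> head R = p \<Longrightarrow> weight R \<le> imp (impl R) v (hat neg M (body R))"
  shows "M p = v"
proof -
  define J where "J = M(p := v)"
  have JM: "J q \<le> M q" for q using v by (simp add: J_def)
  have "satisfies imp neg J (reduct_rule neg M R)" if R: "R \<in> P" for R
  proof -
    have agg: "aggregator_operator (length (pos_atoms R @ neg_atoms R)) (aggr R)"
      and i: "impl R \<in> {1..r}"
      using P R unfolding manlp_def by blast+
    have anti: "antimono (imp (impl R) z)" for z
      using mal i unfolding multi_adjoint_lattice_def adjoint_pair_def by auto
    \<comment> \<open>The reduct freezes the negated atoms at their values under \<open>M\<close>,
      so passing to \<open>J\<close> affects only positive atoms, which cannot increase.\<close>
    have "list_all2 (\<le>) (map J (pos_atoms R) @ map (\<lambda>q. neg (M q)) (neg_atoms R))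
        (map M (pos_atoms R) @ map (\<lambda>q. neg (M q)) (neg_atoms R))"
      by (intro list_all2_appendI) (simp_all add: list_all2_map1 list_all2_map2 list_all2_same JM)
    then have "hat neg J (body (reduct_rule neg M R)) \<le> hat neg M (body R)"
      unfolding hat_body_reduct_rule hat_body[of neg M R]
      using agg by (intro aggregator_operator_mono) simp_all
    then have "imp (impl R) (J (head R)) (hat neg M (body R)) \<le>
        imp (impl R) (J (head R)) (hat neg J (body (reduct_rule neg M R)))"
      using anti by (rule antimonoD[rotated])
    \<comment> \<open>If the head is \<open>p\<close>, this is \<open>heads\<close>; otherwise
      \<open>J\<close> and \<open>M\<close> agree at the head.\<close>
    moreover have "weight R \<le> imp (impl R) (J (head R)) (hat neg M (body R))"
      using heads[OF R] stable_model_weight_le[OF M R] by (auto simp: J_def)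
    ultimately have "weight R \<le>
        imp (impl R) (J (head R)) (hat neg J (body (reduct_rule neg M R)))"
      by (rule order_trans[rotated])
    then show ?thesis
      by (simp add: satisfies_def) (simp add: reduct_rule_def)
  qed
  \<comment> \<open>The update stays inside the domain because \<open>p\<close> is a symbol of
    \<open>P\<close>.\<close>
  moreover have "J \<in> symbols P \<rightarrow>\<^sub>E UNIV"
    using M p by (auto simp: J_def stable_model_def least_model_def model_def PiE_iff
        extensional_def)
  ultimately have "model imp neg (symbols P) (reduct neg M P) J"
    by (auto simp: model_def reduct_def)
  then have "M p \<le> J p"
    using M p by (simp add: stable_model_def least_model_def)
  then show ?thesis using v by (simp add: J_def)
qed

text \<open>Adjointness turns the left side into \<open>amp i top y \<le> z\<close>, and
  \<open>top\<close> is a unit of \<open>amp i\<close>.\<close>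

lemma top_le_imp_iff:
  assumes "multi_adjoint_lattice r amp imp" and "i \<in> {1..r}"
  shows "top \<le> imp i z y \<longleftrightarrow> y \<le> z"
  using assms unfolding multi_adjoint_lattice_def adjoint_pair_def by metis

text \<open>Freshness rules out the translated rules, whose heads lie in \<open>esymbols Pe\<close>;
  injectivity of \<open>nt\<close> rules out the negation rules of other symbols.\<close>

lemma corresponding_manlp_head_nt:
  assumes fresh: "fresh_symbols nt Pe" and q: "q \<in> reversing_symbols Pe"
    and R: "R \<in> corresponding_manlp agg neg nt j Pe" and hd: "head R = nt q"
  shows "R = not_rule j nt q"
  using R unfolding corresponding_manlp_def
proof (elim UnE imageE)
  fix S assume S: "R = corresponding_rule agg neg nt S" "S \<in> Pe"
  then have "nt q \<in> esymbols Pe"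
    using hd by (force simp: corresponding_rule_def esymbols_def)
  then show ?thesis using fresh q by (auto simp: fresh_symbols_def)
next
  fix s assume "R = not_rule j nt s" "s \<in> reversing_symbols Pe"
  then show ?thesis
    using fresh q hd by (auto simp: fresh_symbols_def not_rule_def dest: inj_onD)
qed

theorem theorem24:
  fixes r k :: nat
    and amp imp :: "nat \<Rightarrow> 'l::complete_lattice \<Rightarrow> 'l \<Rightarrow> 'l"
    and agg :: "nat \<Rightarrow> 'l ext_aggregator"
    and Pe :: "('a, 'l) erule set"
    and neg :: "'l \<Rightarrow> 'l"
    and nt :: "'a \<Rightarrow> 'a"
    and j :: "'a \<Rightarrow> nat"
    and M :: "'a \<Rightarrow> 'l"
  assumes "extended_multi_adjoint_lattice r amp imp k agg"
    and "constraint_free_emalp r k agg Pe"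
    and "negation_operator neg" and "involutive neg"
    and "fresh_symbols nt Pe"
    and "\<forall>q\<in>reversing_symbols Pe. j q \<in> {1..r}"
    and "stable_model imp neg (corresponding_manlp agg neg nt j Pe) M"
  shows "\<forall>q\<in>reversing_symbols Pe. M (nt q) = hat neg M (Neg (Atom q))"
proof
  fix q assume q: "q \<in> reversing_symbols Pe"
  let ?P = "corresponding_manlp agg neg nt j Pe"
  have mal: "multi_adjoint_lattice r amp imp"
    using assms(1) by (simp add: extended_multi_adjoint_lattice_def)
  have P: "manlp r ?P"
    using manlp_corresponding_manlp assms(1-3,5,6) .
  have jq: "j q \<in> {1..r}" using assms(6) q by blast
  have rule_body: "hat neg M (body (not_rule j nt q)) = neg (M q)"
    by (simp add: hat_body not_rule_def)
  have "not_rule j nt q \<in> ?P" using q by (simp add: corresponding_manlp_def)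
  from stable_model_weight_le[OF assms(7) this] have "neg (M q) \<le> M (nt q)"
    unfolding rule_body by (simp add: not_rule_def top_le_imp_iff[OF mal jq] del: top.extremum_unique)
  moreover have "nt q \<in> symbols ?P"
    using q by (simp add: symbols_corresponding_manlp)
  \<comment> \<open>The only such rule has weight \<open>top\<close> and body value
    \<open>neg (M q)\<close>, so the condition reduces to reflexivity.\<close>
  moreover have "weight R \<le> imp (impl R) (neg (M q)) (hat neg M (body R))"
    if "R \<in> ?P" "head R = nt q" for R
    unfolding corresponding_manlp_head_nt[OF assms(5) q that] rule_body
    by (simp add: not_rule_def top_le_imp_iff[OF mal jq] del: top.extremum_unique)
  ultimately have "M (nt q) = neg (M q)"
    by (intro stable_model_value_least[OF mal P assms(7)])
  then show "M (nt q) = hat neg M (Neg (Atom q))" by simp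
qed

end
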